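(* Let $P$ be a nonempty finite set of primes, and let $M_P := \sum_{p \in P} \mathbb{N}_0\big[\frac1p\big]$. For any $r,s \in M_P$, the following statements hold. (1) $c_0(r)$ is the largest integer dividing $r$ in $M_P$. (2) If $r \mid_{M_P} s$, then $c_0(r) \le c_0(s)$. (3) If $r \mid_{M_P} s$ and $c_p(r) > c_p(s)$ for some $p \in P$, then $c_0(r) < c_0(s)$.
   Context: For a prime $p$, $\mathbb{N}_0[1/p] = \{f(1/p) : f(x) \in \mathbb{N}_0[x]\}$, regarded as an additive submonoid of $\mathbb{Q}_{\ge 0}$, and $M_P = \{\sum_{p \in P} m_p : m_p \in \mathbb{N}_0[1/p]\}$ is the internal sum inside $\mathbb{Q}_{\ge 0}$. Each $q \in M_P$ can be written uniquely (its canonical sum decomposition) as $q = c_0(q) + \sum_{(p,n) \in P \times \mathbb{N}} c_{p,n}(q) \frac{1}{p^n}$ with $c_0(q) \in \mathbb{N}_0$ and, for each $p \in P$, $(c_{p,n}(q))_{n \ge 1}$ a sequence of integers, almost all zero, with $0 \le c_{p,n}(q) < p$; this defines functions $c_0, c_{p,n} \colon M_P \to \mathbb{N}_0$. For $p \in P$ set $c_p(q) := \sum_{n \in \mathbb{N}} c_{p,n}(q) \frac{1}{p^n}$, so that $q = c_0(q) + \sum_{p \in P} c_p(q)$. For $b, c \in M_P$, $c \mid_{M_P} b$ ("$c$ divides $b$ in $M_P$") means that $b = c + d$ for some $d \in M_P$. Here $\mathbb{N} = \{1,2,\dots\}$ and $\mathbb{N}_0 = \mathbb{N}\cup\{0\}$.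 *)

theory Defs
  imports "HOL-Computational_Algebra.Polynomial" "HOL-Computational_Algebra.Primes"
begin

definition nat_adjoin_inv :: "nat \<Rightarrow> rat set" where
  "nat_adjoin_inv p = {poly (map_poly of_nat f) (1 / of_nat p) | f :: nat poly. True}"

definition MP :: "nat set \<Rightarrow> rat set" where
  "MP P = {\<Sum>p\<in>P. m p | m. \<forall>p\<in>P. m p \<in> nat_adjoin_inv p}"

definition divides_in :: "nat set \<Rightarrow> rat \<Rightarrow> rat \<Rightarrow> bool" where
  "divides_in P c b \<longleftrightarrow> c \<in> MP P \<and> b \<in> MP P \<and> (\<exists>d\<in>MP P. b = c + d)"

text \<open>
  Only the values \<open>c p n\<close> with \<open>p \<in> P\<close> and \<open>n \<ge> 1\<close> are digits of the decomposition; all other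
  values of \<open>c\<close> are unconstrained. The sum over \<open>P \<times> {1..}\<close> is restricted to the nonzero
  digits, because \<open>sum\<close> over an infinite set is \<open>0\<close>.
\<close>
definition canonical_sum_decomp ::
    "nat set \<Rightarrow> rat \<Rightarrow> nat \<Rightarrow> (nat \<Rightarrow> nat \<Rightarrow> nat) \<Rightarrow> bool" where
  "canonical_sum_decomp P q a c \<longleftrightarrow>
     (\<forall>p\<in>P. finite {n. 1 \<le> n \<and> c p n \<noteq> 0}) \<and>
     (\<forall>p\<in>P. \<forall>n\<ge>1. c p n < p) \<and>
     q = of_nat a +
         (\<Sum>(p, n) \<in> {(p, n). p \<in> P \<and> 1 \<le> n \<and> c p n \<noteq> 0}. of_nat (c p n) * (1 / of_nat p ^ n))"

text \<open>
  The definite descriptions below are meaningful when \<open>P\<close> is a finite set of primes, \<open>q \<in> MP P\<close>,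
  and (for the digits) \<open>p \<in> P\<close> and \<open>n \<ge> 1\<close>: the decomposition then exists and is unique.
\<close>
definition c0 :: "nat set \<Rightarrow> rat \<Rightarrow> nat" where
  "c0 P q = (THE a. \<exists>c. canonical_sum_decomp P q a c)"

definition c_digit :: "nat set \<Rightarrow> nat \<Rightarrow> nat \<Rightarrow> rat \<Rightarrow> nat" where
  "c_digit P p n q = (THE k. \<exists>a c. canonical_sum_decomp P q a c \<and> c p n = k)"

definition c_part :: "nat set \<Rightarrow> nat \<Rightarrow> rat \<Rightarrow> rat" where
  "c_part P p q =
     (\<Sum>n | 1 \<le> n \<and> c_digit P p n q \<noteq> 0. of_nat (c_digit P p n q) * (1 / of_nat p ^ n))"

end

theory Submission
  imports Defs
begin

text \<open>
  Cut every summand from \<open>\<nat>\<^sub>0[1/p]\<close> into its integral and fractional part. The fractional parts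
  are determined by the sum: a difference of two of them is a fraction \<open>u / p^K\<close> of absolute value
  below \<open>1\<close>, and multiplying by the denominators at the other primes, which are coprime to \<open>p\<close>,
  shows that it is an integer. So \<open>c0\<close> and \<open>c_part\<close> can be read off any such
  representation, and adding \<open>d\<close> to \<open>r\<close> changes the \<open>p\<close>-part by \<open>c_p(d)\<close> minus
  a carry, all the carries going to \<open>c0\<close>. If \<open>c_p\<close> decreases then there is a carry at \<open>p\<close>.
\<close>

section \<open>Fractions with a prime power denominator\<close>

lemma nat_adjoin_invI: "of_nat k / of_nat p ^ N \<in> nat_adjoin_inv p"
proof -
  have "poly (map_poly of_nat (monom k N)) (1 / of_nat p :: rat) = of_nat k / of_nat p ^ N"
    by (simp add: map_poly_monom poly_monom power_divide)
  then show ?thesis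
    unfolding nat_adjoin_inv_def by (metis (mono_tags, lifting) mem_Collect_eq)
qed

text \<open>Each Horner step \<open>a + x * f(x)\<close> at \<open>x = 1/p\<close> raises the
  exponent of the common denominator by one.\<close>

lemma nat_adjoin_invE:
  assumes "x \<in> nat_adjoin_inv p" and "p > 0"
  obtains k N where "x = of_nat k / of_nat p ^ N"
proof -
  have "\<exists>k N. poly (map_poly of_nat f) (1 / of_nat p :: rat) = of_nat k / of_nat p ^ N" for f :: "nat poly"
  proof (induction f)
    case 0
    show ?case by (auto intro: exI[of _ 0])
  next
    case (pCons a f)
    then obtain k N where "poly (map_poly of_nat f) (1 / of_nat p :: rat) = of_nat k / of_nat p ^ N"
      by blast
    then have "poly (map_poly of_nat (pCons a f)) (1 / of_nat p :: rat)
        = of_nat a + 1 / of_nat p * (of_nat k / of_nat p ^ N)"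
      by (simp add: map_poly_pCons)
    also have "\<dots> = of_nat (a * p ^ Suc N + k) / of_nat p ^ Suc N"
      using \<open>p > 0\<close> by (simp add: field_simps)
    finally have "poly (map_poly of_nat (pCons a f)) (1 / of_nat p :: rat) = \<dots>" .
    then show ?case by blast
  qed
  then show ?thesis
    using assms(1) that unfolding nat_adjoin_inv_def by blast
qed

lemma nat_adjoin_inv_of_nat: "of_nat k \<in> nat_adjoin_inv p"
  using nat_adjoin_invI[of k p 0] by simp

lemma nat_adjoin_inv_nonneg: "x \<in> nat_adjoin_inv p \<Longrightarrow> p > 0 \<Longrightarrow> x \<ge> 0"
  by (elim nat_adjoin_invE) auto

lemma nat_adjoin_inv_add:
  assumes "x \<in> nat_adjoin_inv p" "y \<in> nat_adjoin_inv p" "p > 0"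
  shows "x + y \<in> nat_adjoin_inv p"
proof -
  obtain k N l M where "x = of_nat k / of_nat p ^ N" "y = of_nat l / of_nat p ^ M"
    using assms by (meson nat_adjoin_invE)
  then have "x + y = of_nat (k * p ^ M + l * p ^ N) / of_nat p ^ (N + M)"
    using \<open>p > 0\<close> by (simp add: add_divide_distrib power_add)
  then show ?thesis using nat_adjoin_invI by metis
qed

text \<open>The candidates for a single \<open>c_part\<close>. For \<open>p > 0\<close> this is the
  part of \<open>nat_adjoin_inv p\<close> in [0,1): the lower bound comes with membership.\<close>

definition proper_frac :: "nat \<Rightarrow> rat set" where
  "proper_frac p = {x \<in> nat_adjoin_inv p. x < 1}"

lemma proper_fracI: "k < p ^ N \<Longrightarrow> of_nat k / of_nat p ^ N \<in> proper_frac p"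
  using nat_adjoin_invI[of k p N]
  by (cases "p ^ N = 0") (auto simp: proper_frac_def divide_less_eq simp flip: of_nat_power)

lemma proper_fracE:
  assumes "x \<in> proper_frac p" and "p > 0"
  obtains k N where "k < p ^ N" "x = of_nat k / of_nat p ^ N"
proof -
  obtain k N where x: "x = of_nat k / of_nat p ^ N"
    using assms nat_adjoin_invE unfolding proper_frac_def by blast
  then have "k < p ^ N"
    using assms by (simp add: proper_frac_def divide_less_eq flip: of_nat_power)
  then show ?thesis using x that by blast
qed

text \<open>Divide the numerator by \<open>p ^ N\<close> with remainder.\<close>

lemma nat_adjoin_inv_floor_frac:
  assumes "x \<in> nat_adjoin_inv p" and "p > 0"
  shows "\<exists>a y. y \<in> proper_frac p \<and> x = of_nat a + y"
proof -
  obtain k N where x: "x = of_nat k / of_nat p ^ N"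
    using assms by (elim nat_adjoin_invE)
  have "of_nat k = (of_nat (p ^ N) * of_nat (k div p ^ N) + of_nat (k mod p ^ N) :: rat)"
    by (simp only: flip: of_nat_mult of_nat_add) simp
  then have "x = of_nat (k div p ^ N) + of_nat (k mod p ^ N) / of_nat p ^ N"
    using x \<open>p > 0\<close> by (simp add: field_simps)
  moreover have "of_nat (k mod p ^ N) / of_nat p ^ N \<in> proper_frac p"
    using \<open>p > 0\<close> by (intro proper_fracI) simp
  ultimately show ?thesis by blast
qed

section \<open>Uniqueness of the fractional parts\<close>

lemma proper_frac_diff:
  assumes "x \<in> proper_frac p" "y \<in> proper_frac p" "p > 0"
  obtains u :: int and K where "\<bar>u\<bar> < int p ^ K" "x - y = of_int u / of_nat p ^ K"
proof -
  obtain k N l M where x: "x = of_nat k / of_nat p ^ N" and y: "y = of_nat l / of_nat p ^ M"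
    using assms by (meson proper_fracE)
  define u where "u = int k * int p ^ M - int l * int p ^ N"
  have xy: "x - y = of_int u / of_nat p ^ (N + M)"
    using \<open>p > 0\<close> by (simp add: x y u_def diff_divide_distrib power_add)
  have "\<bar>x - y\<bar> < 1"
    using assms nat_adjoin_inv_nonneg[of x p] nat_adjoin_inv_nonneg[of y p]
    by (auto simp: proper_frac_def)
  then have "(of_int \<bar>u\<bar> :: rat) < of_int (int p ^ (N + M))"
    using \<open>p > 0\<close> by (simp add: xy abs_divide divide_less_eq)
  then have "\<bar>u\<bar> < int p ^ (N + M)"
    by (simp only: of_int_less_iff)
  then show ?thesis using xy that by blast
qed

text \<open>Only the fractional parts are compared; equality of \<open>a\<close> and
  \<open>b\<close> then follows by cancelling the sums.\<close>

lemma sum_proper_frac_unique: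
  assumes fin: "finite P" and pr: "\<And>p. p \<in> P \<Longrightarrow> prime p"
    and x: "\<And>p. p \<in> P \<Longrightarrow> x p \<in> proper_frac p"
    and y: "\<And>p. p \<in> P \<Longrightarrow> y p \<in> proper_frac p"
    and eq: "of_int a + (\<Sum>p\<in>P. x p) = of_int b + (\<Sum>p\<in>P. y p)"
    and p: "p \<in> P"
  shows "x p = y p"
proof -
  have pos: "q > 0" if "q \<in> P" for q
    using pr[OF that] by (rule prime_gt_0_nat)
  have "\<exists>u K. \<bar>u\<bar> < int q ^ K \<and> x q - y q = of_int u / of_nat q ^ K" if "q \<in> P" for q
    using proper_frac_diff[OF x[OF that] y[OF that] pos[OF that]] by blast
  then obtain u K where uK: "\<And>q. q \<in> P \<Longrightarrow> \<bar>u q\<bar> < int q ^ K q"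
      "\<And>q. q \<in> P \<Longrightarrow> x q - y q = of_int (u q) / of_nat q ^ K q"
    by metis
  \<comment> \<open>\<open>Q\<close> clears the denominators at all primes other than
    \<open>p\<close> and is coprime to \<open>p\<close>.\<close>
  define Q where "Q = (\<Prod>q\<in>P-{p}. int q ^ K q)"
  have int: "of_int Q * (x q - y q) \<in> \<int>" if q: "q \<in> P - {p}" for q
  proof -
    have "Q = int q ^ K q * (\<Prod>q\<in>P-{p}-{q}. int q ^ K q)"
      unfolding Q_def using fin q by (intro prod.remove) auto
    then have "of_int Q * (x q - y q) = of_int (u q * (\<Prod>q\<in>P-{p}-{q}. int q ^ K q))"
      using q pos[of q] uK(2)[of q] by simp
    then show ?thesis by (metis Ints_of_int)
  qed
  \<comment> \<open>Isolating the difference at \<open>p\<close> leaves on the right only terms that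
    \<open>Q\<close> makes integral.\<close>
  have "x p - y p = of_int (b - a) - (\<Sum>q\<in>P-{p}. x q - y q)"
    using eq by (simp add: sum.remove[OF fin p] sum_subtractf algebra_simps)
  then have "of_int Q * (x p - y p)
      = of_int (Q * (b - a)) - (\<Sum>q\<in>P-{p}. of_int Q * (x q - y q))"
    by (simp add: right_diff_distrib sum_distrib_left)
  also have "\<dots> \<in> \<int>"
    using int by (intro Ints_diff Ints_sum Ints_of_int) auto
  finally obtain t where "of_int Q * (x p - y p) = of_int t"
    by (elim Ints_cases)
  then have "(of_int (Q * u p) :: rat) = of_int (t * int p ^ K p)"
    using uK(2)[OF p] pos[OF p] by (simp add: field_simps)
  then have "int p ^ K p dvd Q * u p"
    by (metis dvd_triv_right of_int_eq_iff)
  moreover have "coprime (int p ^ K p) Q"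
    unfolding Q_def using pr p
    by (intro prod_coprime_right) (auto simp: primes_coprime coprime_int_iff)
  ultimately have "int p ^ K p dvd u p"
    by (simp add: coprime_dvd_mult_right_iff)
  \<comment> \<open>A nonzero multiple of \<open>p ^ K p\<close> would have absolute value at least
    \<open>p ^ K p\<close>.\<close>
  then have "u p = 0"
    using uK(1)[OF p] by (meson dvd_imp_le_int linorder_not_less abs_ge_zero dual_order.trans abs_ge_self)
  then show ?thesis using uK(2)[OF p] by simp
qed

section \<open>Digits\<close>

text \<open>The range of summation has the same shape as in \<open>c_part\<close>, so that the two
  can be matched term by term.\<close>

definition digit_sum :: "nat \<Rightarrow> (nat \<Rightarrow> nat) \<Rightarrow> rat" where
  "digit_sum p d = (\<Sum>n | 1 \<le> n \<and> d n \<noteq> 0. of_nat (d n) * (1 / of_nat p ^ n))"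

text \<open>The natural number written in base \<open>p\<close> as \<open>d 1\<close>, ...,
  \<open>d N\<close>, most significant digit first; it is the numerator over \<open>p ^ N\<close> of
  the expansion cut off after \<open>N\<close> places. The value \<open>d 0\<close> is
  ignored.\<close>

fun digits_val :: "nat \<Rightarrow> (nat \<Rightarrow> nat) \<Rightarrow> nat \<Rightarrow> nat" where
  "digits_val p d 0 = 0"
| "digits_val p d (Suc N) = p * digits_val p d N + d (Suc N)"

lemma digit_sum_conv_digits_val:
  assumes "{n. 1 \<le> n \<and> d n \<noteq> 0} \<subseteq> {1..N}" and "p > 0"
  shows "digit_sum p d = of_nat (digits_val p d N) / of_nat p ^ N"
proof -
  have "digit_sum p d = (\<Sum>n\<in>{1..N}. of_nat (d n) * (1 / of_nat p ^ n))"
    unfolding digit_sum_def using assms(1) by (intro sum.mono_neutral_left) auto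
  also have "\<dots> = of_nat (digits_val p d N) / of_nat p ^ N"
    using \<open>p > 0\<close> by (induction N) (auto simp: field_simps)
  finally show ?thesis .
qed

lemma digits_val_less:
  assumes "\<And>n. n \<ge> 1 \<Longrightarrow> d n < p"
  shows "digits_val p d N < p ^ N"
proof (induction N)
  case (Suc N)
  have "digits_val p d (Suc N) < p * (digits_val p d N + 1)"
    using assms[of "Suc N"] by simp
  also have "\<dots> \<le> p * p ^ N"
    using Suc by (intro mult_left_mono) auto
  finally show ?case by simp
qed simp

text \<open>Taking \<open>mod p\<close> and \<open>div p\<close> separates the last digit from the
  number formed by the others.\<close>

lemma digits_val_inject:
  assumes "\<And>n. n \<ge> 1 \<Longrightarrow> d n < p" "\<And>n. n \<ge> 1 \<Longrightarrow> e n < p"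
    and "digits_val p d N = digits_val p e N" and "1 \<le> n" "n \<le> N"
  shows "d n = e n"
  using assms(3-5)
proof (induction N)
  case (Suc N)
  have less: "d (Suc N) < p" "e (Suc N) < p" using assms(1,2) by auto
  have "(p * digits_val p d N + d (Suc N)) mod p = (p * digits_val p e N + e (Suc N)) mod p"
    "(p * digits_val p d N + d (Suc N)) div p = (p * digits_val p e N + e (Suc N)) div p"
    using Suc.prems(1) by simp_all
  then have "d (Suc N) = e (Suc N)" "digits_val p d N = digits_val p e N"
    using less by auto
  then show ?case using Suc by (cases "n = Suc N") auto
qed simp

lemma digits_val_cong: "(\<And>n. n \<le> N \<Longrightarrow> d n = e n) \<Longrightarrow> digits_val p d N = digits_val p e N"
  by (induction N) auto

lemma digits_val_exists:
  assumes "k < p ^ N" "p > 0"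
  shows "\<exists>d. (\<forall>n. d n < p) \<and> (\<forall>n>N. d n = 0) \<and> digits_val p d N = k"
  using assms(1)
proof (induction N arbitrary: k)
  case 0
  then show ?case using \<open>p > 0\<close> by (intro exI[of _ "\<lambda>_. 0"]) auto
next
  case (Suc N)
  \<comment> \<open>The quotient by \<open>p\<close> supplies the first \<open>N\<close> digits, the
    remainder becomes digit \<open>Suc N\<close>.\<close>
  have "k div p < p ^ N"
    using Suc.prems \<open>p > 0\<close> by (simp add: div_less_iff_less_mult mult.commute)
  from Suc.IH[OF this] obtain d
    where d: "\<And>n. d n < p" "\<And>n. n > N \<Longrightarrow> d n = 0" "digits_val p d N = k div p" by blast
  have "digits_val p (d(Suc N := k mod p)) N = digits_val p d N"
    by (intro digits_val_cong) auto
  then show ?case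
    using d \<open>p > 0\<close> by (intro exI[of _ "d(Suc N := k mod p)"]) (simp_all del: fun_upd_apply add: fun_upd_same, simp_all)
qed

definition digit_seq :: "nat \<Rightarrow> (nat \<Rightarrow> nat) \<Rightarrow> bool" where
  "digit_seq p d \<longleftrightarrow> finite {n. 1 \<le> n \<and> d n \<noteq> 0} \<and> (\<forall>n\<ge>1. d n < p)"

lemma digit_seq_bounded:
  assumes "digit_seq p d"
  obtains N0 where "\<And>N. N \<ge> N0 \<Longrightarrow> {n. 1 \<le> n \<and> d n \<noteq> 0} \<subseteq> {1..N}"
proof -
  obtain N0 where "\<forall>n\<in>{n. 1 \<le> n \<and> d n \<noteq> 0}. n \<le> N0"
    using assms unfolding digit_seq_def finite_nat_set_iff_bounded_le by blast
  then show ?thesis by (intro that[of N0]) fastforce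
qed

lemma digit_sum_proper_frac:
  assumes "digit_seq p d" "p > 0"
  shows "digit_sum p d \<in> proper_frac p"
proof -
  obtain N where N: "\<And>M. M \<ge> N \<Longrightarrow> {n. 1 \<le> n \<and> d n \<noteq> 0} \<subseteq> {1..M}"
    using digit_seq_bounded[OF assms(1)] by blast
  have "digits_val p d N < p ^ N"
    using assms(1) by (intro digits_val_less) (simp add: digit_seq_def)
  then show ?thesis
    by (simp add: digit_sum_conv_digits_val[OF N[OF order_refl] assms(2)] proper_fracI)
qed

lemma digit_sum_inject:
  assumes "digit_seq p d" "digit_seq p e" "p > 0" "digit_sum p d = digit_sum p e" "n \<ge> 1"
  shows "d n = e n"
proof -
  obtain N1 where N1: "\<And>N. N \<ge> N1 \<Longrightarrow> {n. 1 \<le> n \<and> d n \<noteq> 0} \<subseteq> {1..N}"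
    using digit_seq_bounded[OF assms(1)] by blast
  obtain N2 where N2: "\<And>N. N \<ge> N2 \<Longrightarrow> {n. 1 \<le> n \<and> e n \<noteq> 0} \<subseteq> {1..N}"
    using digit_seq_bounded[OF assms(2)] by blast
  \<comment> \<open>A common length for both expansions that also reaches the digit \<open>n\<close>
    in question.\<close>
  define N where "N = max n (max N1 N2)"
  have "digits_val p d N = digits_val p e N"
    using assms(3,4) digit_sum_conv_digits_val[OF N1[of N] assms(3)]
      digit_sum_conv_digits_val[OF N2[of N] assms(3)] by (simp add: N_def)
  then show ?thesis
    using assms by (intro digits_val_inject[of d p e N n]) (auto simp: digit_seq_def N_def)
qed

text \<open>The digits are those of the numerator in base \<open>p\<close>, padded with leading
  zeros to length \<open>N\<close>.\<close>

lemma proper_frac_digits: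
  assumes "x \<in> proper_frac p" "p > 0"
  shows "\<exists>d. digit_seq p d \<and> digit_sum p d = x"
proof -
  obtain k N where k: "k < p ^ N" "x = of_nat k / of_nat p ^ N"
    using assms by (elim proper_fracE)
  obtain d where d: "\<And>n. d n < p" "\<And>n. n > N \<Longrightarrow> d n = 0" "digits_val p d N = k"
    using digits_val_exists[OF k(1) assms(2)] by blast
  have sub: "{n. 1 \<le> n \<and> d n \<noteq> 0} \<subseteq> {1..N}"
    using d(2) by (auto simp: not_less[symmetric])
  then have "digit_seq p d"
    using d(1) finite_subset unfolding digit_seq_def by blast
  moreover have "digit_sum p d = x"
    using digit_sum_conv_digits_val[OF sub assms(2)] d(3) k(2) by simp
  ultimately show ?thesis by blast
qed

section \<open>The canonical sum decomposition\<close>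

text \<open>Finiteness of \<open>P\<close> and of each digit support allows the sum over pairs to be
  split prime by prime.\<close>

lemma canonical_sum_decomp_iff:
  assumes "finite P"
  shows "canonical_sum_decomp P q a c \<longleftrightarrow>
    (\<forall>p\<in>P. digit_seq p (c p)) \<and> q = of_nat a + (\<Sum>p\<in>P. digit_sum p (c p))"
proof -
  have "(\<Sum>(p, n) \<in> {(p, n). p \<in> P \<and> 1 \<le> n \<and> c p n \<noteq> 0}. of_nat (c p n) * (1 / of_nat p ^ n))
      = (\<Sum>p\<in>P. digit_sum p (c p))" if "\<forall>p\<in>P. digit_seq p (c p)"
  proof -
    have "{(p, n). p \<in> P \<and> 1 \<le> n \<and> c p n \<noteq> 0} = Sigma P (\<lambda>p. {n. 1 \<le> n \<and> c p n \<noteq> 0})"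
      by auto
    then show ?thesis
      unfolding digit_sum_def using assms that by (simp add: digit_seq_def sum.Sigma)
  qed
  then show ?thesis
    unfolding canonical_sum_decomp_def digit_seq_def by auto
qed

locale finite_prime_set =
  fixes P :: "nat set"
  assumes finite_P: "finite P" and prime_P: "\<And>p. p \<in> P \<Longrightarrow> prime p"
begin

lemma pos: "p \<in> P \<Longrightarrow> p > 0"
  using prime_P prime_gt_0_nat by blast

text \<open>Evaluates the definite descriptions: expanding each \<open>x p\<close> in digits gives
  existence; uniqueness of fractional parts, then of their digits, gives the rest. From here on no
  digits are needed.\<close>

lemma c0_c_part_eqI:
  assumes x: "\<And>p. p \<in> P \<Longrightarrow> x p \<in> proper_frac p" and q: "q = of_nat a + (\<Sum>p\<in>P. x p)"
  shows "c0 P q = a" and "p \<in> P \<Longrightarrow> c_part P p q = x p"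
proof -
  have "\<forall>p\<in>P. \<exists>d. digit_seq p d \<and> digit_sum p d = x p"
    using x pos proper_frac_digits by blast
  then obtain c where c: "\<And>p. p \<in> P \<Longrightarrow> digit_seq p (c p)" "\<And>p. p \<in> P \<Longrightarrow> digit_sum p (c p) = x p"
    by metis
  have ex: "canonical_sum_decomp P q a c"
    using c q by (simp add: canonical_sum_decomp_iff[OF finite_P])
  \<comment> \<open>Agreement can hold only at the constrained positions \<open>p \<in> P\<close>,
    \<open>n \<ge> 1\<close>.\<close>
  have uniq: "b = a \<and> (\<forall>p\<in>P. \<forall>n\<ge>1. e p n = c p n)" if "canonical_sum_decomp P q b e" for b e
  proof -
    have e: "\<And>p. p \<in> P \<Longrightarrow> digit_seq p (e p)" "q = of_nat b + (\<Sum>p\<in>P. digit_sum p (e p))"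
      using that by (simp_all add: canonical_sum_decomp_iff[OF finite_P])
    have *: "digit_sum p (e p) = x p" if "p \<in> P" for p
      using sum_proper_frac_unique[OF finite_P prime_P, of "\<lambda>p. digit_sum p (e p)" x "int b" "int a" p]
        e x q that pos digit_sum_proper_frac by simp
    then have "b = a"
      using e(2) q by simp
    moreover have "e p n = c p n" if "p \<in> P" "n \<ge> 1" for p n
      using digit_sum_inject[of p "e p" "c p" n] * c e(1) that pos by simp
    ultimately show ?thesis by blast
  qed
  show "c0 P q = a"
    unfolding c0_def using ex uniq by (intro the_equality) blast+
  assume p: "p \<in> P"
  have digit: "c_digit P p n q = c p n" if "n \<ge> 1" for n
    unfolding c_digit_def using ex uniq p that by (intro the_equality) blast+
  then have "c_part P p q = digit_sum p (c p)"
    unfolding c_part_def digit_sum_def by (intro sum.cong) auto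
  then show "c_part P p q = x p"
    using c(2)[OF p] by simp
qed

lemma sum_floor_frac:
  assumes "\<And>p. p \<in> P \<Longrightarrow> m p \<in> nat_adjoin_inv p"
  obtains a y where "\<And>p. p \<in> P \<Longrightarrow> y p \<in> proper_frac p" "\<And>p. p \<in> P \<Longrightarrow> m p = of_nat (a p) + y p"
    "(\<Sum>p\<in>P. m p) = of_nat (\<Sum>p\<in>P. a p) + (\<Sum>p\<in>P. y p)"
proof -
  have "\<forall>p\<in>P. \<exists>a y. y \<in> proper_frac p \<and> m p = of_nat a + y"
    using assms pos nat_adjoin_inv_floor_frac by blast
  then obtain a y where "\<And>p. p \<in> P \<Longrightarrow> y p \<in> proper_frac p" "\<And>p. p \<in> P \<Longrightarrow> m p = of_nat (a p) + y p"
    by metis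
  then show ?thesis
    using that[of y a] by (simp add: sum.distrib)
qed

lemma c_part_proper_frac:
  assumes "q \<in> MP P"
  shows "p \<in> P \<Longrightarrow> c_part P p q \<in> proper_frac p"
    and "q = of_nat (c0 P q) + (\<Sum>p\<in>P. c_part P p q)"
proof -
  obtain m where m: "\<And>p. p \<in> P \<Longrightarrow> m p \<in> nat_adjoin_inv p" "q = (\<Sum>p\<in>P. m p)"
    using assms unfolding MP_def by blast
  obtain a y where y: "\<And>p. p \<in> P \<Longrightarrow> y p \<in> proper_frac p"
      "q = of_nat (\<Sum>p\<in>P. a p) + (\<Sum>p\<in>P. y p)"
    using sum_floor_frac[OF m(1)] m(2) by metis
  note eq = c0_c_part_eqI[OF y]
  show "p \<in> P \<Longrightarrow> c_part P p q \<in> proper_frac p"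
    using eq(2) y(1) by simp
  show "q = of_nat (c0 P q) + (\<Sum>p\<in>P. c_part P p q)"
    using eq y(2) by simp
qed

section \<open>Carries and divisibility in the monoid\<close>

lemma MP_nonneg: "q \<in> MP P \<Longrightarrow> q \<ge> 0"
  unfolding MP_def using nat_adjoin_inv_nonneg pos by (auto intro!: sum_nonneg)

lemma of_nat_in_MP:
  assumes "P \<noteq> {}"
  shows "of_nat k \<in> MP P"
proof -
  obtain p where p: "p \<in> P" using assms by blast
  \<comment> \<open>The whole of \<open>k\<close> is placed in the summand of one chosen
    prime.\<close>
  have "(of_nat k :: rat) = (\<Sum>q\<in>P. of_nat (if q = p then k else 0))"
    using p finite_P by (simp flip: of_nat_sum)
  then show ?thesis
    unfolding MP_def using nat_adjoin_inv_of_nat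
    by (intro CollectI exI[of _ "\<lambda>q. of_nat (if q = p then k else 0)"]) simp
qed

text \<open>The carry \<open>e p\<close> is the integral part of the sum of the two
  \<open>p\<close>-parts. What remains is again a family of proper fractions, hence the canonical
  one for \<open>r + d\<close>.\<close>

lemma add_carry:
  assumes r: "r \<in> MP P" and d: "d \<in> MP P"
  obtains e where "c0 P (r + d) = c0 P r + c0 P d + (\<Sum>p\<in>P. e p)"
    "\<And>p. p \<in> P \<Longrightarrow> c_part P p r + c_part P p d = of_nat (e p) + c_part P p (r + d)"
proof -
  have mem: "c_part P p r + c_part P p d \<in> nat_adjoin_inv p" if "p \<in> P" for p
    using c_part_proper_frac(1)[OF r that] c_part_proper_frac(1)[OF d that] pos[OF that]
    by (simp add: proper_frac_def nat_adjoin_inv_add)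
  obtain e y where y: "\<And>p. p \<in> P \<Longrightarrow> y p \<in> proper_frac p"
    and e: "\<And>p. p \<in> P \<Longrightarrow> c_part P p r + c_part P p d = of_nat (e p) + y p"
    and sum: "(\<Sum>p\<in>P. c_part P p r + c_part P p d) = of_nat (\<Sum>p\<in>P. e p) + (\<Sum>p\<in>P. y p)"
    by (rule sum_floor_frac[of "\<lambda>p. c_part P p r + c_part P p d"], erule mem) (rule that)
  have "r + d = (of_nat (c0 P r) + (\<Sum>p\<in>P. c_part P p r)) + (of_nat (c0 P d) + (\<Sum>p\<in>P. c_part P p d))"
    using c_part_proper_frac(2)[OF r] c_part_proper_frac(2)[OF d] by simp
  also have "\<dots> = of_nat (c0 P r + c0 P d + (\<Sum>p\<in>P. e p)) + (\<Sum>p\<in>P. y p)"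
    using sum by (simp add: sum.distrib)
  finally have "r + d = \<dots>" .
  note eq = c0_c_part_eqI[OF y this]
  show ?thesis
    using eq e by (intro that[of e]) simp_all
qed

lemma c0_of_nat: "c0 P (of_nat k) = k"
  using proper_fracI[of 0 _ 0] by (intro c0_c_part_eqI(1)[of "\<lambda>_. 0"]) simp_all

lemma c0_mono:
  assumes "divides_in P r s"
  shows "c0 P r \<le> c0 P s"
proof -
  obtain d where d: "r \<in> MP P" "d \<in> MP P" "s = r + d"
    using assms unfolding divides_in_def by blast
  show ?thesis
    using d by (elim add_carry[of r d]) simp_all
qed

lemma c0_strict_mono:
  assumes "divides_in P r s" and p: "p \<in> P" and less: "c_part P p r > c_part P p s"
  shows "c0 P r < c0 P s"
proof -
  obtain d where d: "r \<in> MP P" "d \<in> MP P" "s = r + d"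
    using assms(1) unfolding divides_in_def by blast
  obtain e where e: "c0 P s = c0 P r + c0 P d + (\<Sum>p\<in>P. e p)"
      "\<And>p. p \<in> P \<Longrightarrow> c_part P p r + c_part P p d = of_nat (e p) + c_part P p s"
    using add_carry[OF d(1,2)] d(3) by metis
  have "c_part P p d \<ge> 0"
    using c_part_proper_frac(1)[OF d(2) p] nat_adjoin_inv_nonneg pos[OF p]
    unfolding proper_frac_def by blast
  \<comment> \<open>Without a carry at \<open>p\<close>, the \<open>p\<close>-part of
    \<open>s\<close> would be that of \<open>r\<close> plus a nonnegative number.\<close>
  then have "e p \<noteq> 0"
    using e(2)[OF p] less by (intro notI) simp
  then have "(\<Sum>p\<in>P. e p) > 0"
    using finite_P p by (simp add: sum_pos2)
  then show ?thesis using e(1) by simp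
qed

text \<open>The complementary summand is the sum of the fractional parts.\<close>

lemma c0_divides:
  assumes "P \<noteq> {}" "q \<in> MP P"
  shows "divides_in P (of_nat (c0 P q)) q"
proof -
  have "(\<Sum>p\<in>P. c_part P p q) \<in> MP P"
    using c_part_proper_frac(1)[OF assms(2)] unfolding MP_def proper_frac_def by blast
  then show ?thesis
    using assms c_part_proper_frac(2)[OF assms(2)] of_nat_in_MP unfolding divides_in_def by blast
qed

text \<open>An integer divisor lies in the monoid, so it is a natural number and its own
  \<open>c0\<close>; monotonicity of \<open>c0\<close> under divisibility then bounds it.\<close>

lemma int_divides_le_c0:
  assumes "divides_in P (of_int m) q"
  shows "m \<le> int (c0 P q)"
proof -
  have "(of_int m :: rat) \<ge> 0"
    using assms by (intro MP_nonneg) (simp add: divides_in_def)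
  then have "m \<ge> 0"
    by simp
  then obtain k where "m = int k"
    by (elim nonneg_int_cases)
  then show ?thesis
    using c0_mono[OF assms] by (simp add: c0_of_nat)
qed

end

theorem proposition5p17:
  fixes P :: "nat set" and r s :: rat
  assumes "P \<noteq> {}" and "finite P" and "\<And>p. p \<in> P \<Longrightarrow> prime p"
    and "r \<in> MP P" and "s \<in> MP P"
  shows "(divides_in P (of_nat (c0 P r)) r \<and>
          (\<forall>m::int. divides_in P (of_int m) r \<longrightarrow> m \<le> int (c0 P r))) \<and>
         (divides_in P r s \<longrightarrow> c0 P r \<le> c0 P s) \<and>
         (divides_in P r s \<and> (\<exists>p\<in>P. c_part P p r > c_part P p s) \<longrightarrow> c0 P r < c0 P s)"
proof -
  interpret finite_prime_set P
    by unfold_locales (use assms in auto)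
  show ?thesis
    using assms c0_divides int_divides_le_c0 c0_mono c0_strict_mono by blast
qed

end
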